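(* Let $k\in\mathbb N$ and $\varepsilon,\lambda\in(0,1/2)$. Then there exist two tuples of distributions $\mathcal D=\{f_i\}_{i=1}^k$ and $\mathcal D'=\{f_i'\}_{i=1}^k$ on $[0,1]$ such that every CDF $F$ of a distribution in $\mathcal D$ or $\mathcal D'$ satisfies $|F(x)-F(y)|\ge\lambda|x-y|$ for all $x,y\in[0,1]$, and such that for every $n\le\frac1{10}(\lambda\varepsilon)^{-(k-1)}$ and every estimator $\hat\mu$, $$\max\left(\mathbb P\left\{\mathcal W\big(\hat\mu(\{(Y_j,Z_j)\}_{j=1}^n),\mathcal D\big)\ge\frac{\varepsilon}{8}\right\},\ \mathbb P\left\{\mathcal W\big(\hat\mu(\{(Y_j',Z_j')\}_{j=1}^n),\mathcal D'\big)\ge\frac{\varepsilon}{8}\right\}\right)\ \ge\ \frac13,$$ where $(Y_j,Z_j)$, $j\in[n]$, are drawn i.i.d. from the first-price auction with bid distributions $\mathcal D$, and $(Y_j',Z_j')$, $j\in[n]$, are drawn i.i.d. from the first-price auction with bid distributions $\mathcal D'$.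
   Context: First-price auction data: a sample $(Y,Z)$ from the first-price auction with bid distributions given by a $k$-tuple of distributions on $[0,1]$ is generated by drawing $X_i$ from the $i$-th distribution, independently for $i\in[k]=\{1,\dots,k\}$, and observing $(Y,Z)=(\max_{i\in[k]}X_i,\ \arg\max_{i\in[k]}X_i)$. Estimator: a map $\hat\mu$ taking $n$ observed samples to a $k$-tuple of distributions on $[0,1]$. Wasserstein distance: for distributions $P,Q$ on $[0,1]$, $\mathcal W(P,Q)=\inf_R\mathbb E_{(x,y)\sim R}|x-y|$ over all couplings $R$ of $P$ and $Q$ supported on $[0,1]^2$. For $k$-tuples of distributions, $\mathcal W$ denotes the maximum over $i\in[k]$ of the Wasserstein distances between $i$-th components. *)

theory Defs
  imports "HOL-Probability.Probability"
begin

definition unit_dist :: "real measure \<Rightarrow> bool" where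
  "unit_dist M \<longleftrightarrow> real_distribution M \<and> measure M {0..1} = 1"

text \<open>A \<open>k\<close>-tuple of distributions is a function on \<open>nat\<close>, of which only the values at
  the indices \<open>1, \<dots>, k\<close> matter.\<close>

definition unit_dist_tuple :: "nat \<Rightarrow> (nat \<Rightarrow> real measure) \<Rightarrow> bool" where
  "unit_dist_tuple k D \<longleftrightarrow> (\<forall>i\<in>{1..k}. unit_dist (D i))"

definition unit_couplings :: "real measure \<Rightarrow> real measure \<Rightarrow> (real \<times> real) measure set" where
  "unit_couplings P Q =
    {R. prob_space R \<and> sets R = sets (borel \<Otimes>\<^sub>M borel) \<and>
        measure R ({0..1} \<times> {0..1}) = 1 \<and>
        distr R borel fst = P \<and> distr R borel snd = Q}"

text \<open>For distributions on \<open>[0,1]\<close> the infimum is over a nonempty set of nonnegative reals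
  (the product measure is a coupling), so the real-valued \<open>INF\<close> is the genuine infimum.\<close>

definition wasserstein :: "real measure \<Rightarrow> real measure \<Rightarrow> real" where
  "wasserstein P Q = (INF R\<in>unit_couplings P Q. \<integral>(x, y). \<bar>x - y\<bar> \<partial>R)"

definition wasserstein_tuple ::
    "nat \<Rightarrow> (nat \<Rightarrow> real measure) \<Rightarrow> (nat \<Rightarrow> real measure) \<Rightarrow> real" where
  "wasserstein_tuple k P Q = (MAX i\<in>{1..k}. wasserstein (P i) (Q i))"

text \<open>The law of \<open>(Y, Z) = (max X\<^sub>i, argmax X\<^sub>i)\<close>. The constant \<open>arg_max_on\<close> returns some
  unspecified maximiser, so ties are broken by an arbitrary fixed rule that depends only on the
  set of maximisers.\<close>

definition first_price_auction :: "nat \<Rightarrow> (nat \<Rightarrow> real measure) \<Rightarrow> (real \<times> nat) measure" where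
  "first_price_auction k D =
    distr (Pi\<^sub>M {1..k} D) (borel \<Otimes>\<^sub>M count_space {1..k})
      (\<lambda>X. (MAX i\<in>{1..k}. X i, arg_max_on X {1..k}))"

definition auction_samples ::
    "nat \<Rightarrow> nat \<Rightarrow> (nat \<Rightarrow> real measure) \<Rightarrow> (nat \<Rightarrow> real \<times> nat) measure" where
  "auction_samples n k D = (\<Pi>\<^sub>M j\<in>{1..n}. first_price_auction k D)"

text \<open>The space in which the samples live; it is the same for all tuples \<open>D\<close>.\<close>

definition sample_space :: "nat \<Rightarrow> nat \<Rightarrow> (nat \<Rightarrow> real \<times> nat) measure" where
  "sample_space n k = (\<Pi>\<^sub>M j\<in>{1..n}. borel \<Otimes>\<^sub>M count_space {1..k})"

text \<open>No measurability is built into this notion. Statements about the error probabilities of an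
  estimator additionally assume that the error events in question are measurable, which is what is
  needed for these probabilities to be defined.\<close>

definition estimator :: "nat \<Rightarrow> nat \<Rightarrow> ((nat \<Rightarrow> real \<times> nat) \<Rightarrow> nat \<Rightarrow> real measure) \<Rightarrow> bool" where
  "estimator n k \<mu> \<longleftrightarrow> (\<forall>s\<in>space (sample_space n k). unit_dist_tuple k (\<mu> s))"

end

theory Submission
  imports Defs
begin

text \<open>Only bidder 1 differs between the two auctions: besides density \<open>lam\<close> on \<open>[0,1]\<close>, its bid has
  an atom of mass \<open>1 - lam\<close>, at \<open>0\<close> in the first auction and at \<open>eps\<close> in the second. The other
  bidders have density \<open>lam\<close> on \<open>[0,1]\<close> and an atom at \<open>1\<close>. Moving the atom shifts the mean of
  bidder 1 by \<open>(1 - lam) * eps\<close>, so no estimate is within \<open>eps/8\<close> of both tuples. But it changes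
  the observed outcome only if all other bids are at most \<open>eps\<close>, an event of probability
  \<open>(lam * eps) ^ (k - 1)\<close>. Coupling the samples, the two laws of \<open>n\<close> samples differ by at most
  \<open>n * (lam * eps) ^ (k - 1) \<le> 1/10\<close>, so the two error probabilities add up to at least \<open>9/10\<close>.\<close>

section \<open>Independent coordinates and couplings\<close>

lemma measurable_restrict_coordinatewise:
  assumes "\<And>i. i \<in> I \<Longrightarrow> g i \<in> measurable (M i) (N i)"
  shows "(\<lambda>\<omega>. \<lambda>i\<in>I. g i (\<omega> i)) \<in> measurable (PiM I M) (PiM I N)"
  using assms by (intro measurable_restrict measurable_compose[OF measurable_component_singleton])

text \<open>A finite product measure is determined by its values on boxes, and the preimage of a box
  under a coordinatewise map is again a box, so both sides factor into the same product. It serves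
  twice: to write bids as images of uniform variables, and to write \<open>n\<close> samples as
  images of \<open>n\<close> independent draws.\<close>

lemma distr_PiM_coordinatewise:
  assumes "finite I" and M: "\<And>i. prob_space (M i)"
    and g [measurable]: "\<And>i. g i \<in> measurable (M i) (N i)"
  shows "distr (PiM I M) (PiM I N) (\<lambda>\<omega>. \<lambda>i\<in>I. g i (\<omega> i)) = PiM I (\<lambda>i. distr (M i) (N i) (g i))"
proof -
  interpret M: product_prob_space M I
    using M by (intro product_prob_spaceI) 
  interpret D: product_prob_space "\<lambda>i. distr (M i) (N i) (g i)" I
    using M by (intro product_prob_spaceI prob_space.prob_space_distr) auto
  have [measurable]: "(\<lambda>\<omega>. \<lambda>i\<in>I. g i (\<omega> i)) \<in> measurable (PiM I M) (PiM I N)"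
    by (rule measurable_restrict_coordinatewise) (rule g)
  show ?thesis
  proof (rule D.PiM_eqI[OF \<open>finite I\<close>])
    show "sets (distr (PiM I M) (PiM I N) (\<lambda>\<omega>. \<lambda>i\<in>I. g i (\<omega> i))) =
        sets (PiM I (\<lambda>i. distr (M i) (N i) (g i)))"
      by (simp cong: sets_PiM_cong)
    fix A assume A: "\<And>i. i \<in> I \<Longrightarrow> A i \<in> sets (distr (M i) (N i) (g i))"
    have "(\<lambda>\<omega>. \<lambda>i\<in>I. g i (\<omega> i)) -` Pi\<^sub>E I A \<inter> space (PiM I M) =
        {\<omega> \<in> space (PiM I M). \<forall>i\<in>I. \<omega> i \<in> g i -` A i \<inter> space (M i)}"
      by (auto simp: space_PiM PiE_iff extensional_def)
    moreover have "Pi\<^sub>E I A \<in> sets (PiM I N)"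
      using A \<open>finite I\<close> by (intro sets_PiM_I_finite) auto
    ultimately have "emeasure (distr (PiM I M) (PiM I N) (\<lambda>\<omega>. \<lambda>i\<in>I. g i (\<omega> i))) (Pi\<^sub>E I A) =
        emeasure (PiM I M) {\<omega> \<in> space (PiM I M). \<forall>i\<in>I. \<omega> i \<in> g i -` A i \<inter> space (M i)}"
      by (simp add: emeasure_distr)
    also have "\<dots> = (\<Prod>i\<in>I. emeasure (M i) (g i -` A i \<inter> space (M i)))"
      using A \<open>finite I\<close> by (intro M.emeasure_PiM_Collect) auto
    also have "\<dots> = (\<Prod>i\<in>I. emeasure (distr (M i) (N i) (g i)) (A i))"
      using A by (intro prod.cong) (auto simp: emeasure_distr)
    finally show "emeasure (distr (PiM I M) (PiM I N) (\<lambda>\<omega>. \<lambda>i\<in>I. g i (\<omega> i))) (Pi\<^sub>E I A) =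
        (\<Prod>i\<in>I. emeasure (distr (M i) (N i) (g i)) (A i))" .
  qed
qed

text \<open>Both samples are computed from the same independent draws. They can differ only if some
  draw lands in \<open>E\<close>, and the union bound charges \<open>measure M E\<close> for each
  index in \<open>J\<close>.\<close>

lemma measure_PiM_distr_coupling_le:
  assumes "prob_space M" "finite J"
    and f [measurable]: "f \<in> measurable M N" and g [measurable]: "g \<in> measurable M N"
    and E [measurable]: "E \<in> sets M" and eq: "\<And>\<omega>. \<omega> \<in> space M - E \<Longrightarrow> f \<omega> = g \<omega>"
    and A: "A \<in> sets (PiM J (\<lambda>_. N))"
  shows "measure (PiM J (\<lambda>_. distr M N f)) A
    \<le> measure (PiM J (\<lambda>_. distr M N g)) A + real (card J) * measure M E"
proof -
  interpret M: prob_space M by fact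
  interpret P: product_prob_space "\<lambda>_. M" J
    by (intro product_prob_spaceI) (rule assms(1))
  define h where "h = (\<lambda>f \<omega>. \<lambda>j\<in>J. (f :: 'a \<Rightarrow> 'c) (\<omega> (j :: 'b)))"
  have h [measurable]: "h f \<in> measurable (PiM J (\<lambda>_. M)) (PiM J (\<lambda>_. N))"
    if "f \<in> measurable M N" for f
    unfolding h_def by (rule measurable_restrict_coordinatewise) (rule that)
  have law: "measure (PiM J (\<lambda>_. distr M N f)) A =
      P.prob (h f -` A \<inter> space (PiM J (\<lambda>_. M)))" if "f \<in> measurable M N" for f
  proof -
    have "PiM J (\<lambda>_. distr M N f) = distr (PiM J (\<lambda>_. M)) (PiM J (\<lambda>_. N)) (h f)"
      unfolding h_def using assms(1,2) that by (intro distr_PiM_coordinatewise[symmetric])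
    then show ?thesis
      using measure_distr[OF h[OF that] A] by simp
  qed
  define B where "B = (\<lambda>j. {\<omega> \<in> space (PiM J (\<lambda>_. M)). \<omega> j \<in> E})"
  have B: "B j \<in> P.events" "P.prob (B j) = M.prob E" if "j \<in> J" for j
    using that P.emeasure_PiM_Collect_single[OF that E]
    by (auto simp: B_def measure_def)
  have "h f \<omega> = h g \<omega>" if "\<omega> \<in> space (PiM J (\<lambda>_. M))" "\<omega> \<notin> (\<Union>j\<in>J. B j)" for \<omega>
    using that eq unfolding h_def B_def by (intro restrict_ext) (auto simp: space_PiM PiE_iff)
  then have "h f -` A \<inter> space (PiM J (\<lambda>_. M)) \<subseteq>
      (h g -` A \<inter> space (PiM J (\<lambda>_. M))) \<union> (\<Union>j\<in>J. B j)"
    by auto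
  then have "P.prob (h f -` A \<inter> space (PiM J (\<lambda>_. M))) \<le>
      P.prob ((h g -` A \<inter> space (PiM J (\<lambda>_. M))) \<union> (\<Union>j\<in>J. B j))"
    using A B(1) \<open>finite J\<close>
    by (intro P.finite_measure_mono sets.Un measurable_sets[OF h[OF g] A] sets.finite_UN) auto
  also have "\<dots> \<le> P.prob (h g -` A \<inter> space (PiM J (\<lambda>_. M))) + P.prob (\<Union>j\<in>J. B j)"
    using A B(1) \<open>finite J\<close>
    by (intro measure_subadditive measurable_sets[OF h[OF g] A] sets.finite_UN) (auto simp: P.emeasure_finite)
  also have "P.prob (\<Union>j\<in>J. B j) \<le> (\<Sum>j\<in>J. P.prob (B j))"
    using B(1) \<open>finite J\<close> by (intro P.finite_measure_subadditive_finite) auto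
  also have "\<dots> = real (card J) * M.prob E"
    using B(2) by simp
  finally show ?thesis
    using law[OF f] law[OF g] by simp
qed

section \<open>A mean lower bound for the Wasserstein distance\<close>

lemma unit_dist_integrable:
  assumes "unit_dist P" shows "integrable P (\<lambda>x. x)"
proof -
  interpret real_distribution P using assms by (simp add: unit_dist_def)
  have "AE x in P. x \<in> {0..1}"
    using assms by (intro AE_prob_1) (auto simp: unit_dist_def)
  then have "AE x in P. norm x \<le> 1" by eventually_elim auto
  then show ?thesis by (intro integrable_const_bound) auto
qed

text \<open>A lower bound valid for every coupling passes to the real-valued infimum in
  \<open>wasserstein\<close> only when some coupling exists; the independent one is such a
  witness.\<close>

lemma pair_measure_unit_coupling:
  assumes P: "unit_dist P" and Q: "unit_dist Q"
  shows "P \<Otimes>\<^sub>M Q \<in> unit_couplings P Q"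
proof -
  interpret P: real_distribution P using P by (simp add: unit_dist_def)
  interpret Q: real_distribution Q using Q by (simp add: unit_dist_def)
  interpret PQ: pair_prob_space P Q ..
  have s: "sets (P \<Otimes>\<^sub>M Q) = sets (borel \<Otimes>\<^sub>M borel)"
    by (intro sets_pair_measure_cong) auto
  have 1: "distr (P \<Otimes>\<^sub>M Q) borel fst = P"
    using Q.distr_pair_fst[of P] distr_cong[OF refl, of borel P "P \<Otimes>\<^sub>M Q" fst fst]
    by simp
  have 2: "distr (P \<Otimes>\<^sub>M Q) borel snd = Q"
  proof (rule measure_eqI)
    fix A assume A: "A \<in> sets (distr (P \<Otimes>\<^sub>M Q) borel snd)"
    then have "snd -` A \<inter> space (P \<Otimes>\<^sub>M Q) = space P \<times> A"
      by (auto simp: space_pair_measure)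
    moreover have "snd \<in> measurable (P \<Otimes>\<^sub>M Q) borel"
      by (simp add: measurable_cong_sets[OF s refl])
    ultimately show "emeasure (distr (P \<Otimes>\<^sub>M Q) borel snd) A = emeasure Q A"
      using A P.emeasure_space_1 by (simp add: emeasure_distr Q.emeasure_pair_measure_Times)
  qed simp
  have "emeasure (P \<Otimes>\<^sub>M Q) ({0..1} \<times> {0..1}) = emeasure P {0..1} * emeasure Q {0..1}"
    by (intro Q.emeasure_pair_measure_Times) auto
  then have "measure (P \<Otimes>\<^sub>M Q) ({0..1} \<times> {0..1}) = 1"
    using P Q by (simp add: unit_dist_def measure_def enn2real_mult)
  with s 1 2 show ?thesis
    by (auto simp: unit_couplings_def intro: PQ.prob_space_axioms)
qed

text \<open>This is the easy half of Kantorovich duality for the 1-Lipschitz test function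
  \<open>x\<close>: under any coupling the difference of means is the expectation of
  \<open>fst z - snd z\<close>, which is at most that of its absolute value.\<close>

lemma mean_diff_le_wasserstein:
  assumes P: "unit_dist P" and Q: "unit_dist Q"
  shows "\<bar>(\<integral>x. x \<partial>P) - (\<integral>x. x \<partial>Q)\<bar> \<le> wasserstein P Q"
  unfolding wasserstein_def
proof (rule cINF_greatest)
  show "unit_couplings P Q \<noteq> {}"
    using pair_measure_unit_coupling[OF P Q] by auto
  fix R assume R: "R \<in> unit_couplings P Q"
  then interpret prob_space R by (simp add: unit_couplings_def)
  have s: "sets R = sets (borel \<Otimes>\<^sub>M borel)" and P': "P = distr R borel fst"
    and Q': "Q = distr R borel snd"
    using R by (auto simp: unit_couplings_def)
  have [measurable]: "fst \<in> borel_measurable R" "snd \<in> borel_measurable R"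
    by (simp_all add: measurable_cong_sets[OF s refl])
  have "integrable (distr R borel fst) (\<lambda>x. x)" "integrable (distr R borel snd) (\<lambda>x. x)"
    unfolding P'[symmetric] Q'[symmetric] by (intro unit_dist_integrable P Q)+
  from this[THEN integrable_distr[rotated]] have i: "integrable R fst" "integrable R snd"
    by simp_all
  have "(\<integral>x. x \<partial>P) = (\<integral>z. fst z \<partial>R)"
    by (subst P', rule integral_distr) simp_all
  moreover have "(\<integral>x. x \<partial>Q) = (\<integral>z. snd z \<partial>R)"
    by (subst Q', rule integral_distr) simp_all
  ultimately have "(\<integral>x. x \<partial>P) - (\<integral>x. x \<partial>Q) = (\<integral>z. fst z - snd z \<partial>R)"
    using i by simp
  also have "\<bar>\<dots>\<bar> \<le> (\<integral>z. \<bar>fst z - snd z\<bar> \<partial>R)"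
    using integral_abs_bound .
  finally show "\<bar>(\<integral>x. x \<partial>P) - (\<integral>x. x \<partial>Q)\<bar> \<le> (\<integral>(x, y). \<bar>x - y\<bar> \<partial>R)"
    by (simp add: case_prod_unfold)
qed

section \<open>The auction outcome\<close>

abbreviation auction_outcome :: "'i set \<Rightarrow> ('i \<Rightarrow> real) \<Rightarrow> real \<times> 'i" where
  "auction_outcome I X \<equiv> (MAX i\<in>I. X i, arg_max_on X I)"

text \<open>The tie-breaking choice depends on \<open>X\<close> only through its set of maximisers.\<close>

lemma arg_max_on_eq_some_maximiser:
  fixes X :: "'i \<Rightarrow> 'a::linorder"
  shows "arg_max_on X I = (SOME i. i \<in> {i \<in> I. \<forall>j\<in>I. X j \<le> X i})"
  by (auto simp: arg_max_on_def arg_max_def is_arg_max_def not_less intro!: arg_cong[where f=Eps])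

text \<open>The choice factors through the set of maximisers, which takes values in the finite set
  \<open>Pow I\<close>. Hence only fibres of single sets need checking, each a finite Boolean
  combination of comparisons of coordinates, and whatever rule breaks the ties is then measurable.
  Maximisers exist, so the choice stays in \<open>I\<close>.\<close>

lemma measurable_arg_max_on:
  assumes "finite I" "I \<noteq> {}" and D: "\<And>i. i \<in> I \<Longrightarrow> sets (D i) = sets (borel :: real measure)"
  shows "(\<lambda>X. arg_max_on X I) \<in> measurable (PiM I D) (count_space I)"
proof -
  let ?m = "\<lambda>X :: 'a \<Rightarrow> real. {i \<in> I. \<forall>j\<in>I. X j \<le> X i}"
  have coord [measurable]: "(\<lambda>X. X i) \<in> borel_measurable (PiM I D)" if "i \<in> I" for i
    using measurable_component_singleton[OF that, of D] D[OF that]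
    by (simp cong: measurable_cong_sets)
  have [measurable]: "Measurable.pred (PiM I D) (\<lambda>X. X j \<le> X i)" if "i \<in> I" "j \<in> I" for i j
    using borel_measurable_le[OF coord[OF that(2)] coord[OF that(1)]] by (simp add: pred_def)
  have ne: "\<exists>i. i \<in> ?m X" for X
  proof -
    obtain i where "i \<in> I" "X i = Max (X ` I)"
      using Max_in[of "X ` I"] assms by fastforce
    then show ?thesis using assms(1) by auto
  qed
  have "?m \<in> measurable (PiM I D) (count_space (Pow I))"
  proof (rule measurable_count_space_eq2[THEN iffD2], use assms in simp, intro conjI ballI)
    fix T assume "T \<in> Pow I"
    then have "?m -` {T} \<inter> space (PiM I D) =
        {X \<in> space (PiM I D). \<forall>i\<in>I. (i \<in> T) = (\<forall>j\<in>I. X j \<le> X i)}"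
      by auto
    also have "\<dots> \<in> sets (PiM I D)"
      using assms(1) by measurable
    finally show "?m -` {T} \<inter> space (PiM I D) \<in> sets (PiM I D)" .
  qed auto
  then have "(\<lambda>X. SOME i. i \<in> ?m X) \<in> measurable (PiM I D) (count_space UNIV)"
    by (rule measurable_compose) simp
  moreover have "(SOME i. i \<in> ?m X) \<in> I" for X
    using someI_ex[OF ne[of X]] by auto
  ultimately show ?thesis
    unfolding arg_max_on_eq_some_maximiser
    using assms(1) by (intro measurable_count_space_eq2[THEN iffD2]) (auto simp: Pi_iff)
qed

lemma measurable_auction_outcome:
  assumes "finite I" "I \<noteq> {}" and D: "\<And>i. i \<in> I \<Longrightarrow> sets (D i) = sets (borel :: real measure)"
  shows "auction_outcome I \<in> measurable (PiM I D) (borel \<Otimes>\<^sub>M count_space I)"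
proof (rule measurable_Pair)
  have "(\<lambda>X. X i) \<in> borel_measurable (PiM I D)" if "i \<in> I" for i
    using measurable_component_singleton[OF that, of D] D[OF that]
    by (simp cong: measurable_cong_sets)
  then show "(\<lambda>X. MAX i\<in>I. X i) \<in> borel_measurable (PiM I D)"
    using assms(1) by (intro borel_measurable_Max)
qed (rule measurable_arg_max_on[OF assms])

text \<open>A bidder \<open>a\<close> who is strictly beaten by \<open>j\<close> under both profiles
  is never a maximiser and does not affect the maximum, so the exact value of the losing bid is
  invisible in the outcome.\<close>

lemma auction_outcome_change_loser:
  assumes "finite I" and eq: "\<And>i. i \<in> I \<Longrightarrow> i \<noteq> a \<Longrightarrow> X i = X' i"
    and j: "j \<in> I" "X a < X j" "X' a < X' j"
  shows "auction_outcome I X = auction_outcome I X'"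
proof -
  have "j \<noteq> a" using j by auto
  then have Xj: "X j = X' j" using eq j by auto
  have "{i \<in> I. \<forall>l\<in>I. X l \<le> X i} = {i \<in> I. \<forall>l\<in>I. X' l \<le> X' i}"
  proof (intro Collect_cong conj_cong refl)
    fix i assume "i \<in> I"
    show "(\<forall>l\<in>I. X l \<le> X i) = (\<forall>l\<in>I. X' l \<le> X' i)"
    proof (cases "i = a")
      case True
      then show ?thesis using j by (metis not_less)
    next
      case False
      then have i: "X i = X' i" using eq \<open>i \<in> I\<close> by simp
      have "X a \<le> X i" if "X j \<le> X i" using j that by simp
      moreover have "X' a \<le> X' i" if "X' j \<le> X' i" using j that by simp
      ultimately show ?thesis using eq i j(1) Xj by metis
    qed
  qed
  moreover have "(MAX i\<in>I. X i) = (MAX i\<in>I. X' i)"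
  proof -
    \<comment> \<open>Deleting \<open>a\<close> leaves the maximum unchanged because
      \<open>j\<close> remains and dominates the deleted bid; on \<open>I - {a}\<close> the two
      profiles coincide.\<close>
    have *: "(MAX i\<in>I. Y i) = (MAX i\<in>I - {a}. Y i)" if "Y a < Y j" for Y :: "'a \<Rightarrow> real"
    proof (rule antisym)
      show "(MAX i\<in>I. Y i) \<le> (MAX i\<in>I - {a}. Y i)"
      proof (rule Max.boundedI)
        fix y assume "y \<in> Y ` I"
        then obtain i where i: "i \<in> I" "y = Y i" by auto
        have "Y j \<le> (MAX i\<in>I - {a}. Y i)"
          using assms(1) j \<open>j \<noteq> a\<close> by (intro Max_ge) auto
        moreover have "y \<le> (MAX i\<in>I - {a}. Y i)" if "i \<noteq> a"
          using assms(1) i that by (intro Max_ge) auto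
        ultimately show "y \<le> (MAX i\<in>I - {a}. Y i)"
          using that i by (cases "i = a") auto
      qed (use assms(1) j in auto)
      show "(MAX i\<in>I - {a}. Y i) \<le> (MAX i\<in>I. Y i)"
        using assms(1) j \<open>j \<noteq> a\<close> by (intro Max_mono) auto
    qed
    have "X ` (I - {a}) = X' ` (I - {a})" using eq by (intro image_cong) auto
    with *[of X] *[of X'] j show ?thesis by simp
  qed
  ultimately show ?thesis
    unfolding arg_max_on_eq_some_maximiser by simp
qed

section \<open>Bids as functions of independent uniform variables\<close>

definition unif :: "real measure" where
  "unif = uniform_measure lborel {0..1}"

lemma sets_unif [simp, measurable_cong]: "sets unif = sets borel"
  and space_unif [simp]: "space unif = UNIV"
  by (simp_all add: unif_def)

lemma prob_space_unif: "prob_space unif"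
  unfolding unif_def by (rule prob_space_uniform_measure) auto

lemma measure_unif: "A \<in> sets borel \<Longrightarrow> measure unif A = measure lborel ({0..1} \<inter> A)"
  by (simp add: unif_def)

lemma measure_unif_Ioc: "0 \<le> a \<Longrightarrow> a \<le> b \<Longrightarrow> b \<le> 1 \<Longrightarrow> measure unif {a<..b} = b - a"
  by (subst measure_unif) (auto simp: Int_absorb1 subset_eq)

lemma measure_unif_atMost:
  assumes "0 \<le> a" "a \<le> 1" shows "measure unif {..a} = a"
proof -
  have "{0..1} \<inter> {..a} = {0..a}" using assms by auto
  with assms show ?thesis by (simp add: measure_unif)
qed

lemma unit_dist_distr_unif:
  assumes [measurable]: "g \<in> borel_measurable borel" and g: "g ` {0..1} \<subseteq> {0..1}"
  shows "unit_dist (distr unif borel g)"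
proof -
  interpret prob_space unif by (rule prob_space_unif)
  have "1 = prob {0..1}" by (simp add: measure_unif)
  also have "\<dots> \<le> prob (g -` {0..1})"
    using g by (intro finite_measure_mono) (auto intro: measurable_sets_borel[OF assms(1)])
  finally have "prob (g -` {0..1}) = 1"
    using prob_le_1 by (intro antisym)
  then show ?thesis
    by (auto simp: unit_dist_def measure_distr real_distribution_distr)
qed

lemma integrable_unif:
  fixes g :: "real \<Rightarrow> real"
  assumes "g \<in> borel_measurable borel" "unit_dist (distr unif borel g)"
  shows "integrable unif g"
proof -
  have "g \<in> borel_measurable unif" using assms(1) by simp
  from integrable_distr[OF this unit_dist_integrable[OF assms(2)]] show ?thesis .
qed

lemma mean_distr_unif:
  fixes g :: "real \<Rightarrow> real"
  assumes "g \<in> borel_measurable borel"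
  shows "(\<integral>x. x \<partial>distr unif borel g) = (\<integral>u. g u \<partial>unif)"
proof -
  have "g \<in> borel_measurable unif" using assms by simp
  then show ?thesis by (rule integral_distr) measurable
qed

text \<open>On an interval of length \<open>lam\<close> the map \<open>g\<close> is the affine
  inverse of \<open>c + lam * t\<close>, which already gives each part of \<open>[0,1]\<close> mass
  \<open>lam\<close> times its length. Whatever \<open>g\<close> does elsewhere can only add
  mass.\<close>

lemma cdf_distr_unif_slope:
  fixes c lam :: real
  assumes [measurable]: "g \<in> borel_measurable borel"
    and "0 \<le> c" "0 < lam" "c + lam \<le> 1"
    and g: "\<And>t. 0 < t \<Longrightarrow> t \<le> 1 \<Longrightarrow> g (c + lam * t) = t"
    and x: "x \<in> {0..1}" and y: "y \<in> {0..1}"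
  shows "lam * \<bar>x - y\<bar> \<le> \<bar>cdf (distr unif borel g) x - cdf (distr unif borel g) y\<bar>"
proof -
  interpret U: prob_space unif by (rule prob_space_unif)
  interpret D: real_distribution "distr unif borel g"
    by (rule U.real_distribution_distr) simp
  have *: "lam * (y - x) \<le> cdf (distr unif borel g) y - cdf (distr unif borel g) x"
    if "x < y" "x \<in> {0..1}" "y \<in> {0..1}" for x y :: real
  proof -
    \<comment> \<open>Half-open intervals match the difference of CDF values and avoid
      \<open>t = 0\<close>, where \<open>g\<close> is not controlled: here
      \<open>t > x \<ge> 0\<close>.\<close>
    have sub: "{c + lam * x<..c + lam * y} \<subseteq> g -` {x<..y}"
    proof
      fix u assume u: "u \<in> {c + lam * x<..c + lam * y}"
      define t where "t = (u - c) / lam"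
      have "u = c + lam * t" "x < t" "t \<le> y"
        using u \<open>0 < lam\<close> by (auto simp: t_def field_simps)
      then show "u \<in> g -` {x<..y}" using g[of t] that by auto
    qed
    have "lam * y \<le> lam" using that \<open>0 < lam\<close> by simp
    then have "c + lam * y \<le> 1"
      using \<open>c + lam \<le> 1\<close> by linarith
    moreover have "0 \<le> c + lam * x" "lam * x \<le> lam * y"
      using that assms(2-4) by auto
    ultimately have "lam * (y - x) = measure unif {c + lam * x<..c + lam * y}"
      by (subst measure_unif_Ioc) (auto simp: algebra_simps)
    also have "\<dots> \<le> measure unif (g -` {x<..y})"
      using sub by (intro U.finite_measure_mono) (auto intro: measurable_sets_borel[OF assms(1)])
    also have "\<dots> = cdf (distr unif borel g) y - cdf (distr unif borel g) x"
      using that by (simp add: D.cdf_diff_eq measure_distr)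
    finally show ?thesis .
  qed
  show ?thesis
    using *[of x y] *[of y x] x y by (cases x y rule: linorder_cases) (auto simp: abs_if)
qed

text \<open>This puts auctions with different bid distributions on one common probability space, as
  the coupling bound requires.\<close>

lemma first_price_auction_distr_unif:
  assumes "k \<ge> 1" and g: "\<And>i. g i \<in> borel_measurable borel"
  shows "(\<lambda>\<omega>. auction_outcome {1..k} (\<lambda>i\<in>{1..k}. g i (\<omega> i)))
      \<in> measurable (PiM {1..k} (\<lambda>_. unif)) (borel \<Otimes>\<^sub>M count_space {1..k})" (is "?f \<in> _")
    and "first_price_auction k (\<lambda>i. distr unif borel (g i)) =
      distr (PiM {1..k} (\<lambda>_. unif)) (borel \<Otimes>\<^sub>M count_space {1..k})
        (\<lambda>\<omega>. auction_outcome {1..k} (\<lambda>i\<in>{1..k}. g i (\<omega> i)))"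
proof -
  have g': "g i \<in> borel_measurable unif" for i
    using g by (simp cong: measurable_cong_sets)
  have r: "(\<lambda>\<omega>. \<lambda>i\<in>{1..k}. g i (\<omega> i)) \<in> measurable (PiM {1..k} (\<lambda>_. unif)) (PiM {1..k} (\<lambda>_. borel))"
    by (rule measurable_restrict_coordinatewise) (rule g')
  have o: "auction_outcome {1..k} \<in> measurable (PiM {1..k} (\<lambda>_. borel)) (borel \<Otimes>\<^sub>M count_space {1..k})"
    using \<open>k \<ge> 1\<close> by (intro measurable_auction_outcome) auto
  from measurable_compose[OF r o] show "?f \<in> measurable (PiM {1..k} (\<lambda>_. unif)) (borel \<Otimes>\<^sub>M count_space {1..k})" .
  show "first_price_auction k (\<lambda>i. distr unif borel (g i)) =
      distr (PiM {1..k} (\<lambda>_. unif)) (borel \<Otimes>\<^sub>M count_space {1..k}) ?f"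
    unfolding first_price_auction_def
      distr_PiM_coordinatewise[OF finite_atLeastAtMost prob_space_unif g', symmetric]
    by (subst distr_distr[OF o r]) (simp add: comp_def)
qed

lemma sets_PiM_unif_all_le:
  fixes k :: nat
  shows "{\<omega> \<in> space (PiM {1..k} (\<lambda>_. unif)). \<forall>i\<in>{2..k}. \<omega> i \<in> {..a}} \<in> sets (PiM {1..k} (\<lambda>_. unif))"
proof (rule sets.sets_Collect_finite_All)
  fix i assume "i \<in> {2..k}"
  then have "(\<lambda>\<omega>. \<omega> i) \<in> measurable (PiM {1..k} (\<lambda>_. unif)) unif"
    by (intro measurable_component_singleton) simp
  from measurable_sets[OF this, of "{..a}"]
  show "{\<omega> \<in> space (PiM {1..k} (\<lambda>_. unif)). \<omega> i \<in> {..a}} \<in> sets (PiM {1..k} (\<lambda>_. unif))"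
    by (simp add: vimage_def Int_def conj_commute)
qed simp

text \<open>Coordinate 1 is unconstrained, which leaves \<open>k - 1\<close> independent factors.
  For \<open>k = 1\<close> the event is the whole space and the value is
  \<open>a ^ 0 = 1\<close>.\<close>

lemma measure_PiM_unif_all_le:
  fixes k :: nat
  assumes "0 \<le> a" "a \<le> 1"
  shows "measure (PiM {1..k} (\<lambda>_. unif)) {\<omega> \<in> space (PiM {1..k} (\<lambda>_. unif)). \<forall>i\<in>{2..k}. \<omega> i \<in> {..a}}
    = a ^ (k - 1)"
proof -
  interpret product_prob_space "\<lambda>_. unif" "{1..k}"
    by (intro product_prob_spaceI prob_space_unif)
  have "emeasure (PiM {1..k} (\<lambda>_. unif)) {\<omega> \<in> space (PiM {1..k} (\<lambda>_. unif)). \<forall>i\<in>{2..k}. \<omega> i \<in> {..a}}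
    = (\<Prod>i\<in>{2..k}. emeasure unif {..a})"
    by (rule emeasure_PiM_Collect) auto
  also have "\<dots> = ennreal (a ^ (k - 1))"
    using assms by (simp add: M.emeasure_eq_measure measure_unif_atMost ennreal_power)
  finally show ?thesis using assms by (simp add: measure_def)
qed

section \<open>Two indistinguishable auctions\<close>

theorem theorem2p6:
  fixes k :: nat and eps lam :: real
  assumes "k \<ge> 1" and "0 < eps" "eps < 1/2" and "0 < lam" "lam < 1/2"
  shows "\<exists>D D'. unit_dist_tuple k D \<and> unit_dist_tuple k D' \<and>
    (\<forall>F \<in> (\<lambda>i. cdf (D i)) ` {1..k} \<union> (\<lambda>i. cdf (D' i)) ` {1..k}.
       \<forall>x\<in>{0..1}. \<forall>y\<in>{0..1}. \<bar>F x - F y\<bar> \<ge> lam * \<bar>x - y\<bar>) \<and>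
    (\<forall>n \<mu>. real n \<le> 1/10 * (lam * eps) powi (- (int k - 1)) \<longrightarrow> estimator n k \<mu> \<longrightarrow>
       {s \<in> space (sample_space n k). wasserstein_tuple k (\<mu> s) D \<ge> eps/8} \<in> sets (sample_space n k) \<longrightarrow>
       {s \<in> space (sample_space n k). wasserstein_tuple k (\<mu> s) D' \<ge> eps/8} \<in> sets (sample_space n k) \<longrightarrow>
       max (\<P>(s in auction_samples n k D. wasserstein_tuple k (\<mu> s) D \<ge> eps/8))
           (\<P>(s in auction_samples n k D'. wasserstein_tuple k (\<mu> s) D' \<ge> eps/8)) \<ge> 1/3)"
proof -
  define c where "c = 1 - lam"
  have c: "0 \<le> c" "c + lam = 1" "c \<le> 1" using assms by (auto simp: c_def)
  text \<open>Quantile functions of the bids: an atom is an interval on which the function is constant,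
    and slope \<open>1 / lam\<close> gives density \<open>lam\<close>.\<close>
  define g where "g = (\<lambda>i u. if i = (1::nat) then max 0 ((u - c) / lam) else min 1 (u / lam))"
  \<comment> \<open>Only the constant piece of bidder 1 moves, from \<open>0\<close> to
    \<open>eps\<close>. The new map falls back towards \<open>0\<close> just after \<open>c\<close>,
    so it is not monotone; only its law matters, and this form makes \<open>g\<close> and
    \<open>g'\<close> agree for all \<open>u > c\<close>.\<close>
  define g' where "g' = g(1 := \<lambda>u. if u \<le> c then eps else (u - c) / lam)"
  define D where "D = (\<lambda>i. distr unif borel (g i))"
  define D' where "D' = (\<lambda>i. distr unif borel (g' i))"
  have gm [measurable]: "g i \<in> borel_measurable borel" for i
    unfolding g_def by (cases "i = 1") simp_all
  have g'm [measurable]: "g' i \<in> borel_measurable borel" for i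
    unfolding g'_def fun_upd_def by (cases "i = 1") simp_all
  have unit: "unit_dist (D i)" "unit_dist (D' i)" for i
    using assms c unfolding D_def D'_def
    by (intro unit_dist_distr_unif gm g'm; auto simp: g_def g'_def field_simps)+
  \<comment> \<open>The offset is \<open>c\<close> for bidder 1, whose atom occupies the uniform
    values up to \<open>c\<close>, and \<open>0\<close> for the others, whose atom at
    \<open>1\<close> occupies the values from \<open>lam\<close> on. The case \<open>t = 0\<close>
    is excluded since \<open>g' 1 c = eps\<close>.\<close>
  have g_scale: "g i ((if i = 1 then c else 0) + lam * t) = t"
    "g' i ((if i = 1 then c else 0) + lam * t) = t" if "0 < t" "t \<le> 1" for i t
    using assms that by (simp_all add: g_def g'_def mult_le_0_iff)
  have slope: "lam * \<bar>x - y\<bar> \<le> \<bar>cdf (D i) x - cdf (D i) y\<bar>"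
    "lam * \<bar>x - y\<bar> \<le> \<bar>cdf (D' i) x - cdf (D' i) y\<bar>" if xy: "x \<in> {0..1}" "y \<in> {0..1}" for i x y
  proof -
    have "0 \<le> (if i = 1 then c else 0)" "(if i = 1 then c else 0) + lam \<le> 1"
      using assms c by auto
    note slope = cdf_distr_unif_slope[OF _ this(1) \<open>0 < lam\<close> this(2) _ xy]
    show "lam * \<bar>x - y\<bar> \<le> \<bar>cdf (D i) x - cdf (D i) y\<bar>"
      unfolding D_def by (rule slope[where g = "g i"]) (rule gm, rule g_scale(1))
    show "lam * \<bar>x - y\<bar> \<le> \<bar>cdf (D' i) x - cdf (D' i) y\<bar>"
      unfolding D'_def by (rule slope[where g = "g' i"]) (rule g'm, rule g_scale(2))
  qed

  have means: "(\<integral>x. x \<partial>D' 1) - (\<integral>x. x \<partial>D 1) = eps * c"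
  proof -
    have "(\<integral>x. x \<partial>D' 1) - (\<integral>x. x \<partial>D 1) = (\<integral>u. g' 1 u \<partial>unif) - (\<integral>u. g 1 u \<partial>unif)"
      unfolding D_def D'_def mean_distr_unif[OF gm] mean_distr_unif[OF g'm] ..
    also have "\<dots> = (\<integral>u. g' 1 u - g 1 u \<partial>unif)"
      using unit[unfolded D_def D'_def]
      by (intro Bochner_Integration.integral_diff[symmetric] integrable_unif gm g'm)
    \<comment> \<open>Up to \<open>c\<close> the two maps are constantly \<open>eps\<close> and
      \<open>0\<close>; beyond \<open>c\<close> they coincide.\<close>
    also have "\<dots> = (\<integral>u. eps * indicator {..c} u \<partial>unif)"
      using assms by (intro Bochner_Integration.integral_cong) (auto simp: g_def g'_def field_simps)
    also have "\<dots> = eps * c"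
      using c by (simp add: measure_unif_atMost)
    finally show ?thesis .
  qed

  define \<Omega> where "\<Omega> = PiM {1..k} (\<lambda>_. unif)"
  \<comment> \<open>Since \<open>eps < 1\<close>, a bid \<open>min 1 (u / lam)\<close> is at most
    \<open>eps\<close> exactly when \<open>u \<le> lam * eps\<close>; thus \<open>E\<close> says
    that no competitor of bidder 1 bids above \<open>eps\<close>.\<close>
  define E where "E = {\<omega> \<in> space \<Omega>. \<forall>i\<in>{2..k}. \<omega> i \<in> {..lam * eps}}"
  define out where "out = (\<lambda>(g :: nat \<Rightarrow> real \<Rightarrow> real) \<omega>. auction_outcome {1..k} (\<lambda>i\<in>{1..k}. g i (\<omega> i)))"
  have prob_\<Omega>: "prob_space \<Omega>"
    unfolding \<Omega>_def by (intro prob_space_PiM prob_space_unif)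
  have out: "out g \<in> measurable \<Omega> (borel \<Otimes>\<^sub>M count_space {1..k})"
    "out g' \<in> measurable \<Omega> (borel \<Otimes>\<^sub>M count_space {1..k})"
    unfolding out_def \<Omega>_def
    by (rule first_price_auction_distr_unif(1)[OF \<open>k \<ge> 1\<close>], rule gm g'm)+
  have auction: "first_price_auction k D = distr \<Omega> (borel \<Otimes>\<^sub>M count_space {1..k}) (out g)"
    "first_price_auction k D' = distr \<Omega> (borel \<Otimes>\<^sub>M count_space {1..k}) (out g')"
    unfolding out_def \<Omega>_def D_def D'_def
    by (rule first_price_auction_distr_unif(2)[OF \<open>k \<ge> 1\<close>], rule gm g'm)+
  have E_sets: "E \<in> sets \<Omega>"
    unfolding E_def \<Omega>_def by (rule sets_PiM_unif_all_le)
  have le1: "lam * eps \<le> 1"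
    using mult_mono[of lam 1 eps 1] assms by simp
  then have E_prob: "measure \<Omega> E = (lam * eps) ^ (k - 1)"
    unfolding \<Omega>_def E_def using assms by (intro measure_PiM_unif_all_le) auto
  \<comment> \<open>Either bidder 1 draws from the atom and loses in both auctions to a competitor
    bidding above \<open>eps\<close>, or all bids are literally the same.\<close>
  have agree: "out g \<omega> = out g' \<omega>" if \<omega>: "\<omega> \<in> space \<Omega> - E" for \<omega>
  proof (cases "\<omega> 1 \<le> c")
    case True
    obtain i where i: "i \<in> {2..k}" "\<omega> i > lam * eps"
      using \<omega> by (auto simp: E_def not_le)
    then have "eps < \<omega> i / lam" using assms by (simp add: field_simps)
    then have *: "eps < g i (\<omega> i)" using assms i by (auto simp: g_def)
    have "g 1 (\<omega> 1) = 0"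
      using True assms by (auto simp: g_def field_simps)
    moreover have "g' 1 (\<omega> 1) = eps" using True by (simp add: g'_def)
    moreover have "g' i = g i" using i by (simp add: g'_def)
    ultimately show ?thesis
      unfolding out_def using i * assms
      by (intro auction_outcome_change_loser[where a = 1 and j = i]) (auto simp: g'_def)
  next
    case False
    then have "g 1 (\<omega> 1) = g' 1 (\<omega> 1)"
      using assms by (auto simp: g_def g'_def)
    then have "(\<lambda>i\<in>{1..k}. g i (\<omega> i)) = (\<lambda>i\<in>{1..k}. g' i (\<omega> i))"
      by (auto simp: g'_def fun_eq_iff)
    then show ?thesis unfolding out_def by simp
  qed

  have lower: "1/3 \<le> max (\<P>(s in auction_samples n k D. wasserstein_tuple k (\<mu> s) D \<ge> eps/8))
      (\<P>(s in auction_samples n k D'. wasserstein_tuple k (\<mu> s) D' \<ge> eps/8))"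
    if n: "real n \<le> 1/10 * (lam * eps) powi (- (int k - 1))" and est: "estimator n k \<mu>"
      and B: "{s \<in> space (sample_space n k). wasserstein_tuple k (\<mu> s) D \<ge> eps/8} \<in> sets (sample_space n k)"
        (is "?B \<in> _")
      and B': "{s \<in> space (sample_space n k). wasserstein_tuple k (\<mu> s) D' \<ge> eps/8} \<in> sets (sample_space n k)"
        (is "?B' \<in> _")
    for n \<mu>
  proof -
    let ?P = "auction_samples n k D" and ?P' = "auction_samples n k D'"
    have "sets (first_price_auction k D0) = sets (borel \<Otimes>\<^sub>M count_space {1..k})" for D0
      by (simp only: first_price_auction_def sets_distr)
    then have sets: "sets ?P = sets (sample_space n k)" "sets ?P' = sets (sample_space n k)"
      unfolding auction_samples_def sample_space_def
      by (intro sets_PiM_cong refl; assumption)+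
    have spaces: "space ?P = space (sample_space n k)" "space ?P' = space (sample_space n k)"
      using sets by (auto dest: sets_eq_imp_space_eq)
    interpret P: prob_space ?P
      unfolding auction_samples_def auction
      by (intro prob_space_PiM prob_space.prob_space_distr prob_\<Omega> out)
    \<comment> \<open>An estimate within \<open>eps/8\<close> of both tuples would put the two means
      of bidder 1 within \<open>eps/4\<close> of each other, but they are
      \<open>eps * c \<ge> eps/2\<close> apart because \<open>lam < 1/2\<close>.\<close>
    have "s \<in> ?B \<union> ?B'" if s: "s \<in> space (sample_space n k)" for s
    proof (rule ccontr)
      assume "s \<notin> ?B \<union> ?B'"
      then have "wasserstein_tuple k (\<mu> s) D < eps/8" "wasserstein_tuple k (\<mu> s) D' < eps/8"
        using s by auto
      moreover have "wasserstein (\<mu> s 1) (D 1) \<le> wasserstein_tuple k (\<mu> s) D"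
        "wasserstein (\<mu> s 1) (D' 1) \<le> wasserstein_tuple k (\<mu> s) D'"
        unfolding wasserstein_tuple_def using \<open>k \<ge> 1\<close> by (auto intro!: Max_ge)
      moreover have "unit_dist (\<mu> s 1)"
        using est s \<open>k \<ge> 1\<close> by (auto simp: estimator_def unit_dist_tuple_def)
      note mean_diff_le_wasserstein[OF this unit(1)[of 1]] mean_diff_le_wasserstein[OF this unit(2)[of 1]]
      moreover have "eps / 2 \<le> eps * c"
        using assms by (simp add: c_def)
      ultimately show False
        using means assms(2) by linarith
    qed
    then have "space ?P = ?B \<union> ?B'" using spaces by auto
    then have "1 = P.prob (?B \<union> ?B')" using P.prob_space by simp
    moreover have "P.prob (?B \<union> ?B') \<le> P.prob ?B + P.prob ?B'"
      using B B' sets by (intro measure_subadditive) (auto simp: P.emeasure_finite)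
    \<comment> \<open>Both events have so far been measured under the first auction. The coupling
      moves \<open>?B'\<close> to the second one, at the cost of one
      \<open>measure \<Omega> E\<close> per sample.\<close>
    moreover have "P.prob ?B' \<le> measure ?P' ?B' + real (card {1..n}) * measure \<Omega> E"
      unfolding auction_samples_def auction
      using B' unfolding sample_space_def
      by (intro measure_PiM_distr_coupling_le prob_\<Omega> finite_atLeastAtMost out E_sets agree)
    moreover have "real (card {1..n}) * measure \<Omega> E \<le> 1/10"
    proof -
      \<comment> \<open>The exponent is an integer in the sample bound and a truncated natural
        number in \<open>E_prob\<close>; they match because \<open>k \<ge> 1\<close>.\<close>
      have "- (int k - 1) = - int (k - 1)"
        using \<open>k \<ge> 1\<close> by simp
      then have "(lam * eps) powi (- (int k - 1)) = inverse ((lam * eps) ^ (k - 1))"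
        by (simp only: power_int_minus power_int_of_nat)
      moreover have "0 < (lam * eps) ^ (k - 1)" using assms by simp
      ultimately show ?thesis
        using n unfolding E_prob by (simp add: divide_inverse[symmetric] pos_le_divide_eq)
    qed
    \<comment> \<open>From \<open>1 \<le> P.prob ?B + measure ?P' ?B' + 1/10\<close>; the larger of
      the two error probabilities is then at least \<open>9/20\<close>, more than
      \<open>1/3\<close>.\<close>
    ultimately have "9/10 \<le> P.prob ?B + measure ?P' ?B'"
      by linarith
    then show ?thesis unfolding spaces le_max_iff_disj by linarith
  qed

  have "unit_dist_tuple k D" "unit_dist_tuple k D'"
    using unit by (simp_all add: unit_dist_tuple_def)
  moreover have "\<forall>F \<in> (\<lambda>i. cdf (D i)) ` {1..k} \<union> (\<lambda>i. cdf (D' i)) ` {1..k}.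
      \<forall>x\<in>{0..1}. \<forall>y\<in>{0..1}. \<bar>F x - F y\<bar> \<ge> lam * \<bar>x - y\<bar>"
    using slope by blast
  ultimately show ?thesis
    by (intro exI[of _ D] exI[of _ D'] conjI allI impI) (assumption | rule lower; assumption)+
qed

end
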